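(* Let $M\in\mathbb R^{m\times m}$ be symmetric positive definite or skew-Hermitian, let $f:\mathbb R^m\to\mathbb R^m$ be sufficiently smooth, and consider the initial value problem $y'(t)+My(t)=f(y(t))$, $t\in[t_0,t_{\rm end}]$, $y(t_0)=y_0$. Let $a_{21},a_{31},a_{32},a_{41},a_{42},a_{43},b_1,b_2,b_3,b_4$ be real constants and put $c_i=\sum_{j=1}^{i-1}a_{ij}$ for $i=1,2,3,4$ (so $c_1=0$). Consider the four-stage explicit MVERK method (one step of size $h$ starting from $y_0$) \begin{align*} Y_1&=y_0,\\ Y_2&=y_0+ha_{21}(-MY_1+f(Y_1)),\\ Y_3&=y_0+h\big(a_{31}(-MY_1+f(Y_1))+a_{32}(-MY_2+f(Y_2))\big),\\ Y_4&=y_0+h\big(a_{41}(-MY_1+f(Y_1))+a_{42}(-MY_2+f(Y_2))+a_{43}(-MY_3+f(Y_3))\big),\\ y_1&=e^{-hM}y_0+h\big(b_1f(Y_1)+b_2f(Y_2)+b_3f(Y_3)+b_4f(Y_4)\big)+w_4(z), \end{align*} where, with $g(y_0)=-My_0+f(y_0)$, \begin{align*} w_4(z)=&-\frac{h^2}{2!}Mf(y_0)+\frac{h^3}{3!}\big(M^2f(y_0)-Mf'_y(y_0)g(y_0)\big)+\frac{h^4}{4!}\Big(-M^3f(y_0)+M^2f'_y(y_0)g(y_0)\\ &-Mf''_{yy}(y_0)\big(g(y_0),g(y_0)\big)-Mf'_y(y_0)(-M+f'_y(y_0))g(y_0)\Big). \end{align*} If the coefficients satisfy \begin{align*} &b_1+b_2+b_3+b_4=1,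 && b_2c_2+b_3c_3+b_4c_4=\tfrac12,\\ &b_2c_2^2+b_3c_3^2+b_4c_4^2=\tfrac13, && b_3a_{32}c_2+b_4a_{42}c_2+b_4a_{43}c_3=\tfrac16,\\ &b_2c_2^3+b_3c_3^3+b_4c_4^3=\tfrac14, && b_3c_3a_{32}c_2+b_4c_4a_{42}c_2+b_4c_4a_{43}c_3=\tfrac18,\\ &b_3a_{32}c_2^2+b_4a_{42}c_2^2+b_4a_{43}c_3^2=\tfrac1{12}, && b_4a_{43}a_{32}c_2=\tfrac1{24}, \end{align*} then the method has order four.
   Context: A one-step method is of order $p$ if, under the assumption $y(t_0)=y_0$, the Taylor expansions in $h$ (at $h=0$) of the numerical solution $y_1$ and of the exact solution $y(t_0+h)$ coincide up to and including the $h^p$ term; for $p=4$ this means $y_1-y(t_0+h)=\mathcal O(h^5)$ as $h\to0$. $f'_y(y)$ denotes the Jacobian matrix of $f$ at $y$, and $f''_{yy}(y)(u,v)$ the second derivative of $f$ at $y$ as a symmetric bilinear map applied to $(u,v)$. The symbol $z$ in $w_4(z)$ is only notation indicating dependence on $hM$; $w_4(z)$ is the vector given by the displayed formula. MVERK stands for "modified version of exponential Runge--Kutta". *)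

theory Defs
  imports "HOL-Analysis.Analysis" "HOL-Library.Landau_Symbols"
begin

subsection \<open>Matrices\<close>

definition sym_pos_def :: "real^'n^'n \<Rightarrow> bool" where
  "sym_pos_def M \<longleftrightarrow> transpose M = M \<and> (\<forall>x. x \<noteq> 0 \<longrightarrow> 0 < x \<bullet> (M *v x))"

text \<open>For a real matrix the conjugate transpose is the transpose.\<close>

definition skew_hermitian :: "real^'n^'n \<Rightarrow> bool" where
  "skew_hermitian M \<longleftrightarrow> transpose M = - M"

text \<open>
  The library's \<open>*\<close>, \<open>1\<close> and \<open>^\<close> on \<^typ>\<open>real^'n^'n\<close> are componentwise, so matrix powers
  and the exponential series are spelled out with the matrix product.
\<close>

primrec mat_power :: "real^'n^'n \<Rightarrow> nat \<Rightarrow> real^'n^'n" where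
  "mat_power A 0 = mat 1"
| "mat_power A (Suc k) = A ** mat_power A k"

definition mat_exp :: "real^'n^'n \<Rightarrow> real^'n^'n" where
  "mat_exp A = (\<Sum>k. (1 / fact k) *\<^sub>R mat_power A k)"

subsection \<open>Smoothness and derivatives\<close>

text \<open>
  Class \<open>C\<^sup>k\<close> on the whole space. The derivative is followed through its directional values
  \<open>Df(x)v\<close> for fixed \<open>v\<close>, which keeps the type fixed in the recursion; in finite dimension
  this is the usual notion.
\<close>

primrec Ck :: "nat \<Rightarrow> ('a::euclidean_space \<Rightarrow> 'b::euclidean_space) \<Rightarrow> bool" where
  "Ck 0 f \<longleftrightarrow> continuous_on UNIV f"
| "Ck (Suc k) f \<longleftrightarrow> (\<forall>x. f differentiable (at x)) \<and>
     (\<forall>v. Ck k (\<lambda>x. frechet_derivative f (at x) v))"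

text \<open>
  \<open>f''\<^sub>y\<^sub>y(y)(u,v)\<close>: the derivative of the Jacobian matrix at \<open>y\<close> in direction \<open>u\<close>, applied to \<open>v\<close>.
\<close>

definition second_deriv :: "(real^'n \<Rightarrow> real^'n) \<Rightarrow> real^'n \<Rightarrow> real^'n \<Rightarrow> real^'n \<Rightarrow> real^'n" where
  "second_deriv f y u v = frechet_derivative (\<lambda>x. jacobian f (at x)) (at y) u *v v"

subsection \<open>One-step methods and their order\<close>

definition solves_ivp ::
    "('a::real_normed_vector \<Rightarrow> 'a) \<Rightarrow> real \<Rightarrow> real \<Rightarrow> 'a \<Rightarrow> (real \<Rightarrow> 'a) \<Rightarrow> bool" where
  "solves_ivp G t0 tend y0 y \<longleftrightarrow> y t0 = y0 \<and>
     (\<forall>t\<in>{t0..tend}. (y has_vector_derivative G (y t)) (at t within {t0..tend}))"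

text \<open>
  A one-step method for the autonomous equation \<open>y' = G(y)\<close> is given by its step map
  \<open>y\<^sub>0 \<mapsto> y\<^sub>1 = step h y\<^sub>0\<close>. The solution is given on \<open>[t\<^sub>0, tend]\<close>, hence \<open>h \<rightarrow> 0\<close> from the right.
\<close>

definition has_order ::
    "nat \<Rightarrow> (real \<Rightarrow> 'a::real_normed_vector \<Rightarrow> 'a) \<Rightarrow> ('a \<Rightarrow> 'a) \<Rightarrow> bool" where
  "has_order p step G \<longleftrightarrow>
     (\<forall>t0 tend y0 y. t0 < tend \<longrightarrow> solves_ivp G t0 tend y0 y \<longrightarrow>
        (\<lambda>h. norm (step h y0 - y (t0 + h))) \<in> O[at_right 0](\<lambda>h. h ^ (p + 1)))"

subsection \<open>The four-stage explicit MVERK method\<close>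

definition vfield :: "real^'n^'n \<Rightarrow> (real^'n \<Rightarrow> real^'n) \<Rightarrow> real^'n \<Rightarrow> real^'n" where
  "vfield M f y = - (M *v y) + f y"

definition w4 :: "real^'n^'n \<Rightarrow> (real^'n \<Rightarrow> real^'n) \<Rightarrow> real \<Rightarrow> real^'n \<Rightarrow> real^'n" where
  "w4 M f h y0 =
    (let g = vfield M f y0; J = jacobian f (at y0); M2 = M ** M; M3 = M ** M ** M in
       - ((h^2 / fact 2) *\<^sub>R (M *v f y0))
       + (h^3 / fact 3) *\<^sub>R (M2 *v f y0 - M *v (J *v g))
       + (h^4 / fact 4) *\<^sub>R
           (- (M3 *v f y0) + M2 *v (J *v g) - M *v second_deriv f y0 g g
            - M *v (J *v ((- M + J) *v g))))"

definition mverk4_step ::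
    "(nat \<Rightarrow> nat \<Rightarrow> real) \<Rightarrow> (nat \<Rightarrow> real) \<Rightarrow> real^'n^'n \<Rightarrow> (real^'n \<Rightarrow> real^'n)
      \<Rightarrow> real \<Rightarrow> real^'n \<Rightarrow> real^'n" where
  "mverk4_step a b M f h y0 =
    (let g = vfield M f;
         Y1 = y0;
         Y2 = y0 + (h * a 2 1) *\<^sub>R g Y1;
         Y3 = y0 + h *\<^sub>R (a 3 1 *\<^sub>R g Y1 + a 3 2 *\<^sub>R g Y2);
         Y4 = y0 + h *\<^sub>R (a 4 1 *\<^sub>R g Y1 + a 4 2 *\<^sub>R g Y2 + a 4 3 *\<^sub>R g Y3)
     in mat_exp ((- h) *\<^sub>R M) *v y0
        + h *\<^sub>R (b 1 *\<^sub>R f Y1 + b 2 *\<^sub>R f Y2 + b 3 *\<^sub>R f Y3 + b 4 *\<^sub>R f Y4)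
        + w4 M f h y0)"

end

theory Submission
  imports Defs
begin

text \<open>
  Let \<open>g = G(y\<^sub>0)\<close> for \<open>G(y) = f(y) - My\<close>. Inserting the stage expansions into \<open>f\<close> expands
  \<open>h \<Sum> b\<^sub>i f(Y\<^sub>i)\<close> up to \<open>O(h\<^sup>5)\<close>; under the order conditions the result is that of
  \<open>\<integral> f(y(t\<^sub>0 + s)) ds\<close> over \<open>[0, h]\<close>. What is left of \<open>y(t\<^sub>0 + h)\<close>, namely
  \<open>y\<^sub>0 - M \<integral> y(t\<^sub>0 + s) ds\<close>, is reproduced by the quartic Taylor polynomial of \<open>e\<^sup>-\<^sup>h\<^sup>M y\<^sub>0\<close> together
  with \<open>w\<^sub>4\<close>. The exact solution is expanded by exhibiting a quartic polynomial whose defect in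
  \<open>y' = G(y)\<close> is \<open>O(h\<^sup>4)\<close>.
\<close>

subsection \<open>Taylor's formula with directional derivatives\<close>

text \<open>The direction is the first argument and the base point the last, so
  \<open>dirderiv v\<close> acts on functions and derivatives along one fixed direction are the
  iterates \<open>dirderiv v ^^ k\<close>.\<close>

definition dirderiv :: "'a::euclidean_space \<Rightarrow> ('a \<Rightarrow> 'b::euclidean_space) \<Rightarrow> 'a \<Rightarrow> 'b" where
  "dirderiv v F x = frechet_derivative F (at x) v"

lemma Ck_Suc_iff:
  "Ck (Suc k) F \<longleftrightarrow> (\<forall>x. F differentiable (at x)) \<and> (\<forall>v. Ck k (dirderiv v F))"
  by (simp add: dirderiv_def [abs_def])

lemma Ck_Suc_dirderiv: "Ck (Suc k) F \<Longrightarrow> Ck k (dirderiv v F)"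
  by (simp add: dirderiv_def [abs_def])

lemma Ck_Suc_differentiable: "Ck (Suc k) F \<Longrightarrow> F differentiable (at x)"
  by simp

lemma Ck_SucD: "Ck (Suc k) F \<Longrightarrow> Ck k F"
proof (induction k arbitrary: F)
  case 0
  then show ?case
    by (auto simp: continuous_on_eq_continuous_at intro: differentiable_imp_continuous_within)
next
  case (Suc k)
  then show ?case by (metis Ck_Suc_iff)
qed

lemma Ck_mono: "Ck n F \<Longrightarrow> m \<le> n \<Longrightarrow> Ck m F"
  by (induction n) (auto simp: le_Suc_eq simp del: Ck.simps dest: Ck_SucD)

lemma dirderiv_unique: "(F has_derivative F') (at x) \<Longrightarrow> dirderiv v F x = F' v"
  by (simp add: dirderiv_def frechet_derivative_at [symmetric])

lemma dirderiv_has_derivative: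
  "F differentiable (at x) \<Longrightarrow> (F has_derivative (\<lambda>v. dirderiv v F x)) (at x)"
  by (simp add: dirderiv_def frechet_derivative_works [symmetric])

lemma dirderiv_lincomb:
  assumes "\<And>j x. j \<in> S \<Longrightarrow> F j differentiable (at x)"
  shows "dirderiv v (\<lambda>x. \<Sum>j\<in>S. c j *\<^sub>R F j x) = (\<lambda>x. \<Sum>j\<in>S. c j *\<^sub>R dirderiv v (F j) x)"
proof
  fix x
  have "((\<lambda>x. \<Sum>j\<in>S. c j *\<^sub>R F j x) has_derivative (\<lambda>v. \<Sum>j\<in>S. c j *\<^sub>R dirderiv v (F j) x)) (at x)"
    by (intro has_derivative_sum has_derivative_scaleR_right dirderiv_has_derivative assms)
  then show "dirderiv v (\<lambda>x. \<Sum>j\<in>S. c j *\<^sub>R F j x) x = (\<Sum>j\<in>S. c j *\<^sub>R dirderiv v (F j) x)"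
    by (rule dirderiv_unique)
qed

lemma iterated_dirderiv_lincomb:
  assumes "\<And>j. j \<in> S \<Longrightarrow> Ck k (F j)"
  shows "(dirderiv v ^^ k) (\<lambda>x. \<Sum>j\<in>S. c j *\<^sub>R F j x)
    = (\<lambda>x. \<Sum>j\<in>S. c j *\<^sub>R (dirderiv v ^^ k) (F j) x)"
  using assms
proof (induction k arbitrary: F)
  case (Suc k)
  have d: "dirderiv v (\<lambda>x. \<Sum>j\<in>S. c j *\<^sub>R F j x) = (\<lambda>x. \<Sum>j\<in>S. c j *\<^sub>R dirderiv v (F j) x)"
    using Suc.prems by (intro dirderiv_lincomb) auto
  have "\<And>j. j \<in> S \<Longrightarrow> Ck k (dirderiv v (F j))"
    by (rule Ck_Suc_dirderiv[OF Suc.prems])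
  from Suc.IH[OF this] show ?case
    by (simp only: funpow_Suc_right o_apply d)
qed simp

text \<open>Linearity of the derivative in its direction reduces arbitrary \<open>v\<close> to
  finitely many fixed directions. Estimates can thereby be made uniform in \<open>v\<close>.\<close>

lemma dirderiv_basis:
  assumes "\<And>x. F differentiable (at x)"
  shows "dirderiv v F = (\<lambda>x. \<Sum>i\<in>Basis. (v \<bullet> i) *\<^sub>R dirderiv i F x)"
proof
  fix x
  have lin: "linear (\<lambda>v. dirderiv v F x)"
    using dirderiv_has_derivative[OF assms] has_derivative_linear by blast
  have "dirderiv v F x = dirderiv (\<Sum>i\<in>Basis. (v \<bullet> i) *\<^sub>R i) F x"
    by (simp add: euclidean_representation)
  also have "\<dots> = (\<Sum>i\<in>Basis. (v \<bullet> i) *\<^sub>R dirderiv i F x)"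
    using linear_sum[OF lin, of "\<lambda>i. (v \<bullet> i) *\<^sub>R i" Basis] linear_cmul[OF lin] by simp
  finally show "dirderiv v F x = (\<Sum>i\<in>Basis. (v \<bullet> i) *\<^sub>R dirderiv i F x)" .
qed

text \<open>\<open>Ck\<close> gives continuity, hence boundedness on \<open>S\<close>, only for each
  fixed tuple of directions. Expanding the innermost derivative in the basis yields one factor
  \<open>v \<bullet> i\<close>, at most \<open>norm v\<close>, per differentiation, and the finitely
  many constants \<open>K i\<close> are summed.\<close>

lemma iterated_dirderiv_bound:
  assumes "compact S" "Ck k F"
  shows "\<exists>K\<ge>0. \<forall>v. \<forall>x\<in>S. norm ((dirderiv v ^^ k) F x) \<le> K * norm v ^ k"
  using assms(2)
proof (induction k arbitrary: F)
  case 0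
  then have "compact (F ` S)"
    using assms(1) by (auto intro: compact_continuous_image continuous_on_subset)
  then obtain K where K: "\<forall>y\<in>F ` S. norm y \<le> K"
    by (meson bounded_iff compact_imp_bounded)
  have "norm (F x) \<le> max K 0" if "x \<in> S" for x
    using K that by (simp add: le_max_iff_disj)
  then show ?case by (intro exI[of _ "max K 0"]) simp
next
  case (Suc k)
  have Ck: "Ck k (dirderiv i F)" for i
    by (rule Ck_Suc_dirderiv[OF Suc.prems])
  have "\<forall>i. \<exists>K\<ge>0. \<forall>v. \<forall>x\<in>S. norm ((dirderiv v ^^ k) (dirderiv i F) x) \<le> K * norm v ^ k"
    using Suc.IH Ck by blast
  then obtain K where K0: "\<And>i. K i \<ge> 0"
    and K: "\<And>i v x. x \<in> S \<Longrightarrow> norm ((dirderiv v ^^ k) (dirderiv i F) x) \<le> K i * norm v ^ k"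
    by metis
  have "norm ((dirderiv v ^^ Suc k) F x) \<le> sum K Basis * norm v ^ Suc k" if "x \<in> S" for v x
  proof -
    have "dirderiv v F = (\<lambda>x. \<Sum>i\<in>Basis. (v \<bullet> i) *\<^sub>R dirderiv i F x)"
      using Suc.prems by (intro dirderiv_basis) auto
    then have "(dirderiv v ^^ Suc k) F x
        = (\<Sum>i\<in>Basis. (v \<bullet> i) *\<^sub>R (dirderiv v ^^ k) (dirderiv i F) x)"
      by (simp only: funpow_Suc_right o_apply iterated_dirderiv_lincomb[OF Ck])
    also have "norm \<dots> \<le> (\<Sum>i\<in>Basis. norm v * (K i * norm v ^ k))"
      using K[OF that] K0 by (intro sum_norm_le) (auto intro!: mult_mono simp: Basis_le_norm)
    also have "\<dots> = sum K Basis * norm v ^ Suc k"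
      by (simp add: sum_distrib_left sum_distrib_right mult_ac)
    finally show ?thesis .
  qed
  then show ?case using K0 by (intro exI[of _ "sum K Basis"]) (auto intro: sum_nonneg)
qed

text \<open>Taylor's formula with integral remainder on the segment from \<open>x\<close> to
  \<open>x + v\<close>, which convexity keeps inside \<open>S\<close>. The kernel is at most 1
  there, so the constant of \<open>iterated_dirderiv_bound\<close> serves for all \<open>x\<close>
  and \<open>v\<close>.\<close>

lemma Taylor_bound:
  assumes S: "compact S" "convex S" and F: "Ck n F" and n: "0 < n"
  shows "\<exists>K\<ge>0. \<forall>x v. x \<in> S \<longrightarrow> x + v \<in> S \<longrightarrow>
    norm (F (x + v) - (\<Sum>i<n. (1 / fact i) *\<^sub>R (dirderiv v ^^ i) F x)) \<le> K * norm v ^ n"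
proof -
  obtain K where K0: "K \<ge> 0"
    and K: "\<And>v x. x \<in> S \<Longrightarrow> norm ((dirderiv v ^^ n) F x) \<le> K * norm v ^ n"
    using iterated_dirderiv_bound[OF S(1) F] by metis
  have Ck: "Ck (n - m) ((dirderiv v ^^ m) F)" if "m \<le> n" for m v
    using that
  proof (induction m)
    case (Suc m)
    then have "Ck (Suc (n - Suc m)) ((dirderiv v ^^ m) F)" by (simp add: Suc_diff_Suc del: Ck.simps)
    then show ?case by (metis Ck_Suc_iff funpow.simps(2) o_apply)
  qed (use F in simp)
  have "norm (F (x + v) - (\<Sum>i<n. (1 / fact i) *\<^sub>R (dirderiv v ^^ i) F x)) \<le> K * norm v ^ n"
    if x: "x \<in> S" "x + v \<in> S" for x v
  proof -
    \<comment> \<open>By the chain rule along the segment, \<open>g (Suc m)\<close> is the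
      derivative of \<open>g m\<close>, which turns the problem into a one-dimensional one.\<close>
    define g where "g m t = (dirderiv v ^^ m) F (x + t *\<^sub>R v)" for m and t :: real
    have "(g m has_vector_derivative g (Suc m) t) (at t within {0..1})" if "m < n" for m t
    proof -
      have "Ck (Suc (n - Suc m)) ((dirderiv v ^^ m) F)"
        using Ck[of m v] that by (simp add: Suc_diff_Suc del: Ck.simps)
      then have "((dirderiv v ^^ m) F has_derivative (\<lambda>w. dirderiv w ((dirderiv v ^^ m) F) (x + t *\<^sub>R v))) (at (x + t *\<^sub>R v))"
        by (intro dirderiv_has_derivative) auto
      moreover have "((\<lambda>t. x + t *\<^sub>R v) has_vector_derivative v) (at t)"
        by (auto intro!: derivative_eq_intros)
      ultimately have "(((dirderiv v ^^ m) F \<circ> (\<lambda>t. x + t *\<^sub>R v)) has_vector_derivative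
          dirderiv v ((dirderiv v ^^ m) F) (x + t *\<^sub>R v)) (at t)"
        by (rule vector_derivative_diff_chain_within[rotated, OF has_derivative_at_withinI])
      then show ?thesis
        by (auto simp: g_def[abs_def] o_def intro: has_vector_derivative_at_within)
    qed
    then have I: "((\<lambda>t. ((1 - t) ^ (n - 1) / fact (n - 1)) *\<^sub>R g n t) has_integral
        g 0 1 - (\<Sum>i<n. ((1 - 0) ^ i / fact i) *\<^sub>R g i 0)) {0..1}"
      by (intro Taylor_has_integral n) auto
    have bound: "norm (((1 - t) ^ (n - 1) / fact (n - 1)) *\<^sub>R g n t) \<le> K * norm v ^ n"
      if t: "t \<in> {0..1}" for t
    proof -
      have "x + t *\<^sub>R v = (1 - t) *\<^sub>R x + t *\<^sub>R (x + v)" by (simp add: algebra_simps)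
      then have "x + t *\<^sub>R v \<in> S"
        using S(2) x t by (auto intro!: convexD)
      then have "norm (g n t) \<le> K * norm v ^ n" using K by (simp add: g_def)
      moreover have "\<bar>(1 - t) ^ (n - 1) / fact (n - 1)\<bar> \<le> 1"
      proof -
        have "(1 - t) ^ (n - 1) \<le> 1" using t by (intro power_le_one) auto
        also have "1 \<le> (fact (n - 1) :: real)" by (rule fact_ge_1)
        finally show ?thesis using t by simp
      qed
      ultimately show ?thesis
        using mult_mono[of "\<bar>(1 - t) ^ (n - 1) / fact (n - 1)\<bar>" 1 "norm (g n t)" "K * norm v ^ n"]
        by simp
    qed
    have "norm (g 0 1 - (\<Sum>i<n. ((1 - 0) ^ i / fact i) *\<^sub>R g i 0))
        \<le> K * norm v ^ n * measure lborel {0..1::real}"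
      using I bound K0 by (intro has_integral_bound_real) auto
    then show ?thesis by (simp add: g_def)
  qed
  with K0 show ?thesis by blast
qed

subsection \<open>Asymptotic expansions at the right of zero\<close>

text \<open>This is \<open>O(h^n)\<close> from the right of zero, with local boundedness as the case
  \<open>n = 0\<close>. The side matches \<open>has_order\<close>, where the solution is given only
  for \<open>t \<ge> t0\<close>.\<close>

definition vanishes :: "nat \<Rightarrow> (real \<Rightarrow> 'a::real_normed_vector) \<Rightarrow> bool" where
  "vanishes n F \<longleftrightarrow> (\<exists>K. \<forall>\<^sub>F h in at_right 0. norm (F h) \<le> K * h ^ n)"

lemma eventually_small: "0 < r \<Longrightarrow> \<forall>\<^sub>F h in at_right (0::real). 0 < h \<and> h < r"
  unfolding eventually_at_right_field by blast

lemma vanishesE: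
  assumes "vanishes n F"
  obtains K where "K \<ge> 0" "\<forall>\<^sub>F h in at_right 0. norm (F h) \<le> K * h ^ n"
proof -
  obtain K where K: "\<forall>\<^sub>F h in at_right 0. norm (F h) \<le> K * h ^ n"
    using assms by (auto simp: vanishes_def)
  have "\<forall>\<^sub>F h in at_right 0. norm (F h) \<le> max K 0 * h ^ n"
    using K eventually_small[OF zero_less_one]
  proof eventually_elim
    case (elim h)
    then have "K * h ^ n \<le> max K 0 * h ^ n" by (intro mult_right_mono) auto
    with elim show ?case by linarith
  qed
  then show ?thesis by (intro that[of "max K 0"]) auto
qed

lemma vanishes_add:
  assumes "vanishes n F" "vanishes n G"
  shows "vanishes n (\<lambda>h. F h + G h)"
proof -
  obtain K L where "\<forall>\<^sub>F h in at_right 0. norm (F h) \<le> K * h ^ n"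
    "\<forall>\<^sub>F h in at_right 0. norm (G h) \<le> L * h ^ n"
    using assms by (auto simp: vanishes_def)
  then have "\<forall>\<^sub>F h in at_right 0. norm (F h + G h) \<le> (K + L) * h ^ n"
    by eventually_elim (smt (verit) norm_triangle_ineq distrib_right)
  then show ?thesis by (auto simp: vanishes_def)
qed

lemma vanishes_linear:
  assumes "bounded_linear L" "vanishes n F"
  shows "vanishes n (\<lambda>h. L (F h))"
proof -
  obtain C where C: "C \<ge> 0" "\<And>x. norm (L x) \<le> norm x * C"
    using bounded_linear.nonneg_bounded[OF assms(1)] by auto
  obtain K where "\<forall>\<^sub>F h in at_right 0. norm (F h) \<le> K * h ^ n"
    using assms by (auto simp: vanishes_def)
  then have "\<forall>\<^sub>F h in at_right 0. norm (L (F h)) \<le> K * C * h ^ n"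
    by eventually_elim
      (metis C mult.assoc mult.commute mult_left_mono order.trans)
  then show ?thesis by (auto simp: vanishes_def)
qed

lemma vanishes_bilinear:
  assumes "bounded_bilinear B" "vanishes m F" "vanishes n G"
  shows "vanishes (m + n) (\<lambda>h. B (F h) (G h))"
proof -
  obtain C where C: "C \<ge> 0" "\<And>x y. norm (B x y) \<le> norm x * norm y * C"
    using bounded_bilinear.nonneg_bounded[OF assms(1)] by auto
  obtain K where K: "K \<ge> 0" "\<forall>\<^sub>F h in at_right 0. norm (F h) \<le> K * h ^ m"
    using assms by (auto elim: vanishesE)
  obtain L where L: "L \<ge> 0" "\<forall>\<^sub>F h in at_right 0. norm (G h) \<le> L * h ^ n"
    using assms by (auto elim: vanishesE)
  have "\<forall>\<^sub>F h in at_right 0. norm (B (F h) (G h)) \<le> K * L * C * h ^ (m + n)"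
    using K(2) L(2) eventually_small[OF zero_less_one]
  proof eventually_elim
    case (elim h)
    have "norm (B (F h) (G h)) \<le> norm (F h) * norm (G h) * C" by (rule C)
    also have "\<dots> \<le> (K * h ^ m) * (L * h ^ n) * C"
      using elim C K L by (intro mult_mono) auto
    finally show ?case by (simp add: power_add mult_ac)
  qed
  then show ?thesis by (auto simp: vanishes_def)
qed

lemma vanishes_minus: "vanishes n F \<Longrightarrow> vanishes n (\<lambda>h. - F h)"
  by (simp add: vanishes_def)

lemma vanishes_diff: "vanishes n F \<Longrightarrow> vanishes n G \<Longrightarrow> vanishes n (\<lambda>h. F h - G h)"
  using vanishes_add[of n F "\<lambda>h. - G h"] by (simp add: vanishes_minus)

lemma vanishes_continuous:
  assumes "isCont F 0"
  shows "vanishes 0 F"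
proof -
  have "(F \<longlongrightarrow> F 0) (at_right 0)"
    using assms by (simp add: isCont_def filterlim_at_split)
  then have "((\<lambda>h. norm (F h)) \<longlongrightarrow> norm (F 0)) (at_right 0)"
    by (rule tendsto_norm)
  then have "\<forall>\<^sub>F h in at_right 0. norm (F h) < norm (F 0) + 1"
    by (rule order_tendstoD) simp
  then have "\<forall>\<^sub>F h in at_right 0. norm (F h) \<le> (norm (F 0) + 1) * h ^ 0"
    by eventually_elim simp
  then show ?thesis by (auto simp: vanishes_def)
qed

lemma vanishes_power: "vanishes n (\<lambda>h. h ^ n :: real)"
proof -
  have "\<forall>\<^sub>F h in at_right 0. norm (h ^ n :: real) \<le> 1 * h ^ n"
    using eventually_small[OF zero_less_one] by eventually_elim simp
  then show ?thesis unfolding vanishes_def by blast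
qed

lemma vanishes_scale_power: "vanishes n F \<Longrightarrow> vanishes (m + n) (\<lambda>h. h ^ m *\<^sub>R F h)"
  by (rule vanishes_bilinear[OF bounded_bilinear_scaleR vanishes_power])

lemma vanishes_mono:
  assumes "vanishes n F" "m \<le> n"
  shows "vanishes m F"
proof -
  obtain K where K: "K \<ge> 0" "\<forall>\<^sub>F h in at_right 0. norm (F h) \<le> K * h ^ n"
    using assms by (auto elim: vanishesE)
  have "\<forall>\<^sub>F h in at_right 0. norm (F h) \<le> K * h ^ m"
    using K(2) eventually_small[OF zero_less_one]
  proof eventually_elim
    case (elim h)
    then have "K * h ^ n \<le> K * h ^ m"
      using K assms(2) by (intro mult_left_mono power_decreasing) auto
    with elim show ?case by linarith
  qed
  then show ?thesis by (auto simp: vanishes_def)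
qed

lemma vanishes_tendsto:
  assumes "vanishes n F" "0 < n"
  shows "(F \<longlongrightarrow> 0) (at_right 0)"
proof -
  obtain K where K: "\<forall>\<^sub>F h in at_right 0. norm (F h) \<le> K * h ^ n"
    using assms by (auto simp: vanishes_def)
  have "((\<lambda>h. K * h ^ n) \<longlongrightarrow> K * 0 ^ n) (at_right 0)"
    by (intro tendsto_intros)
  then have "((\<lambda>h. K * h ^ n) \<longlongrightarrow> 0) (at_right 0)" using assms(2) by (simp add: power_0_left)
  then show ?thesis using K by (rule Lim_null_comparison[rotated])
qed

lemma vanishes_bound:
  assumes "vanishes n F" "\<forall>\<^sub>F h in at_right 0. norm (G h) \<le> C * norm (F h)" "C \<ge> 0"
  shows "vanishes n G"
proof -
  obtain K where "\<forall>\<^sub>F h in at_right 0. norm (F h) \<le> K * h ^ n"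
    using assms by (auto simp: vanishes_def)
  with assms(2) have "\<forall>\<^sub>F h in at_right 0. norm (G h) \<le> C * K * h ^ n"
    by eventually_elim (metis assms(3) mult.assoc mult_left_mono order.trans)
  then show ?thesis by (auto simp: vanishes_def)
qed

text \<open>A remainder of order 4 suffices for the stages and for the values of \<open>f\<close> on
  them: the method multiplies these values by \<open>h\<close>, which raises the error to order
  5.\<close>

definition expan4 :: "(real \<Rightarrow> 'a::real_normed_vector) \<Rightarrow> 'a \<Rightarrow> 'a \<Rightarrow> 'a \<Rightarrow> 'a \<Rightarrow> bool" where
  "expan4 v q0 q1 q2 q3 \<longleftrightarrow>
     vanishes 4 (\<lambda>h. v h - (q0 + h *\<^sub>R q1 + h ^ 2 *\<^sub>R q2 + h ^ 3 *\<^sub>R q3))"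

text \<open>Composed expansion rules produce raw coefficients by unification; this rule leaves their
  agreement with the intended closed forms as separate equations.\<close>

lemma expan4_eq:
  assumes "expan4 v q0 q1 q2 q3" "q0 = r0" "q1 = r1" "q2 = r2" "q3 = r3"
  shows "expan4 v r0 r1 r2 r3"
  using assms by simp

lemma expan4_poly:
  assumes "isCont w 0"
  shows "expan4 (\<lambda>h. q0 + h *\<^sub>R q1 + h ^ 2 *\<^sub>R q2 + h ^ 3 *\<^sub>R q3 + h ^ 4 *\<^sub>R w h) q0 q1 q2 q3"
  using vanishes_scale_power[OF vanishes_continuous[OF assms], of 4] by (simp add: expan4_def)

lemma expan4_const: "expan4 (\<lambda>h. q) q 0 0 0"
  using expan4_poly[of "\<lambda>h. 0" q 0 0 0] by simp

lemma expan4_add: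
  assumes "expan4 v q0 q1 q2 q3" "expan4 w r0 r1 r2 r3"
  shows "expan4 (\<lambda>h. v h + w h) (q0 + r0) (q1 + r1) (q2 + r2) (q3 + r3)"
  using vanishes_add[OF assms[unfolded expan4_def]] by (simp add: expan4_def algebra_simps)

lemma expan4_linear:
  assumes "bounded_linear L" "expan4 v q0 q1 q2 q3"
  shows "expan4 (\<lambda>h. L (v h)) (L q0) (L q1) (L q2) (L q3)"
proof -
  interpret bounded_linear L by fact
  show ?thesis
    using vanishes_linear[OF assms(1) assms(2)[unfolded expan4_def]]
    by (simp add: expan4_def diff add scaleR)
qed

lemma expan4_scaleR: "expan4 v q0 q1 q2 q3 \<Longrightarrow>
    expan4 (\<lambda>h. c *\<^sub>R v h) (c *\<^sub>R q0) (c *\<^sub>R q1) (c *\<^sub>R q2) (c *\<^sub>R q3)"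
  by (rule expan4_linear[OF bounded_linear_scaleR_right])

lemma expan4_sum:
  assumes "\<And>i. i \<in> S \<Longrightarrow> expan4 (v i) (q0 i) (q1 i) (q2 i) (q3 i)"
  shows "expan4 (\<lambda>h. \<Sum>i\<in>S. v i h) (\<Sum>i\<in>S. q0 i) (\<Sum>i\<in>S. q1 i) (\<Sum>i\<in>S. q2 i) (\<Sum>i\<in>S. q3 i)"
  using assms by (induction S rule: infinite_finite_induct) (auto intro: expan4_const expan4_add)

text \<open>The factor \<open>h\<close> moves every coefficient up by one degree, and the former
  cubic term becomes quartic and joins the remainder.\<close>

lemma expan4_shift:
  assumes "expan4 v q0 q1 q2 q3"
  shows "expan4 (\<lambda>h. h *\<^sub>R v h) 0 q0 q1 q2"
proof -
  have "vanishes 4 (\<lambda>h. h ^ 1 *\<^sub>R (v h - (q0 + h *\<^sub>R q1 + h ^ 2 *\<^sub>R q2 + h ^ 3 *\<^sub>R q3)))"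
    using vanishes_scale_power[OF assms[unfolded expan4_def], of 1] vanishes_mono by fastforce
  from vanishes_add[OF this, of "\<lambda>h. h ^ 4 *\<^sub>R q3"]
  have "vanishes 4 (\<lambda>h. h ^ 1 *\<^sub>R (v h - (q0 + h *\<^sub>R q1 + h ^ 2 *\<^sub>R q2 + h ^ 3 *\<^sub>R q3)) + h ^ 4 *\<^sub>R q3)"
    using vanishes_scale_power[OF vanishes_continuous, of "\<lambda>h. q3" 4] by simp
  then show ?thesis
    by (simp add: expan4_def algebra_simps power2_eq_square power3_eq_cube power4_eq_xxxx)
qed

lemma expan4_vanishes:
  assumes "expan4 v q0 q1 q2 q3"
  shows "vanishes 1 (\<lambda>h. v h - q0)"
proof -
  have "vanishes 1 (\<lambda>h. h ^ 1 *\<^sub>R (q1 + h *\<^sub>R q2 + h ^ 2 *\<^sub>R q3))"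
    using vanishes_scale_power[OF vanishes_continuous, of "\<lambda>h. q1 + h *\<^sub>R q2 + h ^ 2 *\<^sub>R q3" 1]
    by (simp add: continuous_intros)
  from vanishes_add[OF vanishes_mono[OF assms[unfolded expan4_def], of 1] this]
  show ?thesis
    by (simp add: algebra_simps power2_eq_square power3_eq_cube)
qed

lemma expan4_bounded:
  assumes "expan4 v q0 q1 q2 q3"
  shows "vanishes 0 v"
  using vanishes_add[OF vanishes_mono[OF expan4_vanishes[OF assms], of 0] vanishes_continuous[of "\<lambda>h. q0"]]
  by simp

text \<open>The coefficients are those of the Cauchy product. The error splits into
  \<open>B (v - P) w\<close>, \<open>B P (w - Q)\<close> and the part of \<open>B P Q\<close> of
  degree at least 4.\<close>

lemma expan4_bilinear:
  assumes B: "bounded_bilinear B" and v: "expan4 v q0 q1 q2 q3" and w: "expan4 w r0 r1 r2 r3"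
  shows "expan4 (\<lambda>h. B (v h) (w h)) (B q0 r0) (B q0 r1 + B q1 r0)
    (B q0 r2 + B q1 r1 + B q2 r0) (B q0 r3 + B q1 r2 + B q2 r1 + B q3 r0)"
proof -
  interpret bounded_bilinear B by fact
  define P where "P h = q0 + h *\<^sub>R q1 + h ^ 2 *\<^sub>R q2 + h ^ 3 *\<^sub>R q3" for h
  define Q where "Q h = r0 + h *\<^sub>R r1 + h ^ 2 *\<^sub>R r2 + h ^ 3 *\<^sub>R r3" for h
  \<comment> \<open>The terms of degrees 4, 5 and 6 in \<open>B (P h) (Q h)\<close>, after removal
    of the factor \<open>h^4\<close>.\<close>
  define c where "c h = (B q1 r3 + B q2 r2 + B q3 r1) + h *\<^sub>R (B q2 r3 + B q3 r2) + h ^ 2 *\<^sub>R B q3 r3" for h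
  have 1: "vanishes (4 + 0) (\<lambda>h. B (v h - P h) (w h))"
    using v expan4_bounded[OF w] by (intro vanishes_bilinear[OF B]) (auto simp: expan4_def P_def)
  have "isCont P 0" unfolding P_def by (intro continuous_intros)
  then have 2: "vanishes (0 + 4) (\<lambda>h. B (P h) (w h - Q h))"
    using w by (intro vanishes_bilinear[OF B] vanishes_continuous) (auto simp: expan4_def Q_def)
  have "isCont c 0" unfolding c_def by (intro continuous_intros)
  then have 3: "vanishes (4 + 0) (\<lambda>h. h ^ 4 *\<^sub>R c h)"
    by (intro vanishes_scale_power vanishes_continuous)
  have "vanishes 4 (\<lambda>h. B (v h - P h) (w h) + B (P h) (w h - Q h) + h ^ 4 *\<^sub>R c h)"
    using 1 2 3 by (intro vanishes_add) auto
  also have "(\<lambda>h. B (v h - P h) (w h) + B (P h) (w h - Q h) + h ^ 4 *\<^sub>R c h)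
    = (\<lambda>h. B (v h) (w h) - (B q0 r0 + h *\<^sub>R (B q0 r1 + B q1 r0)
    + h ^ 2 *\<^sub>R (B q0 r2 + B q1 r1 + B q2 r0) + h ^ 3 *\<^sub>R (B q0 r3 + B q1 r2 + B q2 r1 + B q3 r0)))"
    by (simp add: fun_eq_iff P_def Q_def c_def diff_left diff_right add_left add_right scaleR_left
        scaleR_right algebra_simps power2_eq_square power3_eq_cube power4_eq_xxxx)
  finally show ?thesis by (simp add: expan4_def)
qed

subsection \<open>Taylor expansion of a vector field along a curve\<close>

lemma bounded_linear_matrix_vector_mult_left: "bounded_linear (\<lambda>A :: real^'n^'m. A *v x)"
  by (intro linear_conv_bounded_linear[THEN iffD1] linearI)
    (simp_all add: matrix_vector_mult_add_rdistrib scaleR_matrix_vector_assoc)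

lemma dirderiv_eq_jacobian:
  fixes F :: "real^'n \<Rightarrow> real^'m"
  assumes "F differentiable (at x)"
  shows "dirderiv v F x = jacobian F (at x) *v v"
  using assms by (intro dirderiv_unique) (simp add: jacobian_works)

text \<open>Links the matrix-valued derivative in \<open>second_deriv\<close> to the directional
  derivatives controlled by \<open>Ck\<close>. Each entry of the Jacobian is a component of some
  \<open>dirderiv (axis j 1) F\<close>, so the Jacobian is differentiable, and applying it to a
  fixed \<open>v\<close> is bounded linear.\<close>

lemma second_deriv_eq_dirderiv:
  fixes F :: "real^'n \<Rightarrow> real^'n"
  assumes "Ck 2 F"
  shows "second_deriv F y u v = dirderiv u (dirderiv v F) y"
proof -
  have F: "Ck (Suc (Suc 0)) F" using assms by (simp add: numeral_2_eq_2 del: Ck.simps)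
  note d = Ck_Suc_differentiable[OF F]
  note d1 = Ck_Suc_differentiable[OF Ck_Suc_dirderiv[OF F]]
  have "(\<lambda>x. jacobian F (at x)) differentiable (at y)"
  proof (subst differentiable_componentwise_within, intro ballI)
    fix b :: "real^'n^'n" assume "b \<in> Basis"
    then obtain i j where b: "b = axis i (axis j 1)" by (auto simp: Basis_vec_def)
    have "jacobian F (at x) \<bullet> b = dirderiv (axis j 1) F x $ i" for x
      by (simp add: b dirderiv_eq_jacobian[OF d] inner_axis matrix_vector_mul_component inner_axis')
    moreover have "(\<lambda>x. dirderiv (axis j 1) F x $ i) differentiable (at y)"
      using differentiable_compose[of "\<lambda>z. z $ i" "dirderiv (axis j 1) F" y UNIV, OF _ d1]
        bounded_linear_imp_differentiable[OF bounded_linear_vec_nth] by auto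
    ultimately show "(\<lambda>x. jacobian F (at x) \<bullet> b) differentiable (at y)" by simp
  qed
  then have "((\<lambda>x. jacobian F (at x)) has_derivative frechet_derivative (\<lambda>x. jacobian F (at x)) (at y)) (at y)"
    by (simp add: frechet_derivative_works [symmetric])
  then have "((\<lambda>x. jacobian F (at x) *v v) has_derivative
      (\<lambda>u. frechet_derivative (\<lambda>x. jacobian F (at x)) (at y) u *v v)) (at y)"
    by (rule bounded_linear.has_derivative[OF bounded_linear_matrix_vector_mult_left])
  moreover have "dirderiv v F = (\<lambda>x. jacobian F (at x) *v v)"
    using dirderiv_eq_jacobian[OF d] by blast
  ultimately have "(dirderiv v F has_derivative
      (\<lambda>u. frechet_derivative (\<lambda>x. jacobian F (at x)) (at y) u *v v)) (at y)"
    by simp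
  from dirderiv_unique[OF this, of u] show ?thesis
    by (simp add: second_deriv_def)
qed

lemma bounded_bilinear_second_deriv:
  fixes F :: "real^'n \<Rightarrow> real^'n"
  assumes "Ck 2 F"
  shows "bounded_bilinear (second_deriv F y)"
proof -
  have F: "Ck (Suc (Suc 0)) F" using assms by (simp add: numeral_2_eq_2 del: Ck.simps)
  note d1 = Ck_Suc_differentiable[OF Ck_Suc_dirderiv[OF F]]
  have "linear (\<lambda>u. second_deriv F y u v)" for v
    using has_derivative_linear[OF dirderiv_has_derivative[OF d1]]
    by (simp add: second_deriv_eq_dirderiv[OF assms])
  moreover have "linear (second_deriv F y u)" for u
    unfolding second_deriv_def [abs_def] by simp
  ultimately show ?thesis
    by (simp add: bilinear_conv_bounded_bilinear [symmetric] bilinear_def)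
qed

text \<open>
  The third derivative is only needed on the diagonal; the cubic form \<open>T\<close> expands one
  slot in the basis, so no symmetry of higher derivatives is used.
\<close>

lemma expan4_compose:
  fixes F :: "real^'n \<Rightarrow> real^'n"
  assumes F: "Ck 4 F" and v: "expan4 v y p1 p2 p3"
  defines "J \<equiv> jacobian F (at y)" and "B \<equiv> second_deriv F y"
    and "T \<equiv> \<lambda>p. \<Sum>i\<in>Basis. (p \<bullet> i) *\<^sub>R second_deriv (dirderiv i F) y p p"
  shows "expan4 (\<lambda>h. F (v h)) (F y) (J *v p1) (J *v p2 + (1/2) *\<^sub>R B p1 p1)
    (J *v p3 + (1/2) *\<^sub>R (B p1 p2 + B p2 p1) + (1/6) *\<^sub>R T p1)"
proof -
  have F3: "Ck (Suc 3) F" using F by (simp del: Ck.simps)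
  note Ck_dir = Ck_Suc_dirderiv[OF F3] and d = Ck_Suc_differentiable[OF F3]
  have Ck2: "Ck 2 F" "Ck 2 (dirderiv i F)" for i
    using Ck_mono[OF F] Ck_mono[OF Ck_dir] by (simp_all del: Ck.simps)
  \<comment> \<open>The displacement has no constant term, so its quadratic form starts at
    \<open>h^2\<close> and its cubic form at \<open>h^3\<close>.\<close>
  define u where "u h = v h - y" for h
  have u: "expan4 u 0 p1 p2 p3"
    using v by (simp add: expan4_def u_def algebra_simps)
  have u1: "vanishes 1 u" using expan4_vanishes[OF u] by simp
  have eJ: "expan4 (\<lambda>h. J *v u h) 0 (J *v p1) (J *v p2) (J *v p3)"
    using expan4_linear[OF matrix_vector_mul_bounded_linear u, of J] by simp
  have eB: "expan4 (\<lambda>h. second_deriv G y (u h) (u h)) 0 0 (second_deriv G y p1 p1)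
      (second_deriv G y p1 p2 + second_deriv G y p2 p1)" if "Ck 2 G" for G
  proof -
    have bil: "bounded_bilinear (second_deriv G y)" by (rule bounded_bilinear_second_deriv[OF that])
    show ?thesis
      using expan4_bilinear[OF bil u u]
      by (simp add: bounded_bilinear.zero_left[OF bil] bounded_bilinear.zero_right[OF bil])
  qed
  have "expan4 (\<lambda>h. (u h \<bullet> i) *\<^sub>R second_deriv (dirderiv i F) y (u h) (u h)) 0 0 0
      ((p1 \<bullet> i) *\<^sub>R second_deriv (dirderiv i F) y p1 p1)" for i
    using expan4_bilinear[OF bounded_bilinear_scaleR
        expan4_linear[OF bounded_linear_inner_left u, of i] eB[OF Ck2(2)], of i] by simp
  then have eT: "expan4 (\<lambda>h. T (u h)) 0 0 0 (T p1)"
    unfolding T_def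
    using expan4_sum[of Basis "\<lambda>i h. (u h \<bullet> i) *\<^sub>R second_deriv (dirderiv i F) y (u h) (u h)"
        "\<lambda>_. 0" "\<lambda>_. 0" "\<lambda>_. 0" "\<lambda>i. (p1 \<bullet> i) *\<^sub>R second_deriv (dirderiv i F) y p1 p1"]
    by simp
  let ?P = "\<lambda>u. F y + J *v u + (1/2) *\<^sub>R B u u + (1/6) *\<^sub>R T u"
  have Taylor_poly: "(\<Sum>i<4. (1 / fact i) *\<^sub>R (dirderiv w ^^ i) F y) = ?P w" for w
  proof -
    have 1: "dirderiv w F y = J *v w" unfolding J_def by (rule dirderiv_eq_jacobian[OF d])
    have 2: "dirderiv w (dirderiv w F) y = B w w"
      unfolding B_def by (rule second_deriv_eq_dirderiv[OF Ck2(1), symmetric])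
    \<comment> \<open>Only the innermost of the three derivatives is expanded in the basis; the
      outer two become \<open>second_deriv (dirderiv i F)\<close>, which gives
      \<open>T\<close>.\<close>
    have "(dirderiv w ^^ 2) (dirderiv w F) y
        = (\<Sum>i\<in>Basis. (w \<bullet> i) *\<^sub>R (dirderiv w ^^ 2) (dirderiv i F) y)"
      by (subst dirderiv_basis[OF d], subst iterated_dirderiv_lincomb[OF Ck2(2)]) simp
    then have 3: "dirderiv w (dirderiv w (dirderiv w F)) y = T w"
      by (simp add: T_def eval_nat_numeral second_deriv_eq_dirderiv[OF Ck2(2)] )
    have four: "{..<4::nat} = {0,1,2,3}" by auto
    have c: "(dirderiv w ^^ 2) F = dirderiv w (dirderiv w F)"
      "(dirderiv w ^^ 3) F = dirderiv w (dirderiv w (dirderiv w F))"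
      by (simp_all add: eval_nat_numeral)
    show ?thesis by (simp add: four c 1 2 3 fact_numeral)
  qed
  obtain K where K: "K \<ge> 0"
    "\<And>x w. x \<in> cball y 1 \<Longrightarrow> x + w \<in> cball y 1 \<Longrightarrow>
      norm (F (x + w) - (\<Sum>i<4. (1 / fact i) *\<^sub>R (dirderiv w ^^ i) F x)) \<le> K * norm w ^ 4"
    using Taylor_bound[OF compact_cball convex_cball F, of y 1] by auto
  obtain K' where K': "K' \<ge> 0" "\<forall>\<^sub>F h in at_right 0. norm (u h) \<le> K' * h ^ 1"
    using u1 by (rule vanishesE)
  \<comment> \<open>The Taylor constant belongs to the unit ball around \<open>y\<close>, so the
    displacement must eventually stay inside it.\<close>
  have "\<forall>\<^sub>F h in at_right 0. dist (u h) 0 < 1"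
    using vanishes_tendsto[OF u1] by (intro tendstoD) auto
  with K'(2) have "\<forall>\<^sub>F h in at_right 0. norm (F (v h) - ?P (u h)) \<le> K * K' ^ 4 * h ^ 4"
  proof eventually_elim
    case (elim h)
    have "norm (F (y + u h) - ?P (u h)) \<le> K * norm (u h) ^ 4"
      using K(2)[of y "u h", unfolded Taylor_poly] elim(2) by (simp add: dist_norm)
    also have "\<dots> \<le> K * (K' * h) ^ 4"
      using elim K(1) by (intro mult_left_mono power_mono) auto
    finally show ?case by (simp add: u_def power_mult_distrib mult_ac)
  qed
  then have R: "vanishes 4 (\<lambda>h. F (v h) - ?P (u h))" unfolding vanishes_def by blast
  then have "expan4 (\<lambda>h. F (v h) - ?P (u h)) 0 0 0 0" by (simp add: expan4_def)
  from expan4_add[OF this expan4_add[OF expan4_add[OF expan4_add[OF expan4_const[of "F y"] eJ]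
      expan4_scaleR[OF eB[OF Ck2(1)], where c = "1/2"]] expan4_scaleR[OF eT, where c = "1/6"]]]
  show ?thesis unfolding B_def by simp
qed

subsection \<open>Approximate solutions\<close>

text \<open>Taylor's bound with \<open>n = 1\<close> and increment \<open>z - x\<close>: the Taylor
  polynomial is then just \<open>F x\<close>.\<close>

lemma Ck_locally_Lipschitz:
  assumes "Ck 1 F"
  shows "\<exists>K\<ge>0. \<forall>x\<in>cball y r. \<forall>z\<in>cball y r. norm (F z - F x) \<le> K * norm (z - x)"
proof -
  obtain K where "K \<ge> 0" and K: "\<And>x w. x \<in> cball y r \<Longrightarrow> x + w \<in> cball y r \<Longrightarrow>
      norm (F (x + w) - (\<Sum>i<1. (1 / fact i) *\<^sub>R (dirderiv w ^^ i) F x)) \<le> K * norm w ^ 1"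
    using Taylor_bound[OF compact_cball convex_cball assms zero_less_one, of y r] by auto
  have "norm (F z - F x) \<le> K * norm (z - x)" if "x \<in> cball y r" "z \<in> cball y r" for x z
    using K[of x "z - x"] that by simp
  with \<open>K \<ge> 0\<close> show ?thesis by blast
qed

text \<open>
  Bootstrapping instead of Gronwall: by the Lipschitz bound, an error \<open>O(h\<^sup>m)\<close> with \<open>m \<le> n\<close> has derivative
  \<open>O(h\<^sup>m)\<close>, and the mean value inequality turns this into \<open>O(h\<^sup>m\<^sup>+\<^sup>1)\<close>.
\<close>

lemma solution_minus_approximation:
  assumes y: "solves_ivp G t0 tend y0 y" and t: "t0 < tend"
    and Lip: "K \<ge> 0" "\<And>x z. x \<in> cball y0 1 \<Longrightarrow> z \<in> cball y0 1 \<Longrightarrow> norm (G z - G x) \<le> K * norm (z - x)"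
    and Q: "\<And>s. (Q has_vector_derivative Q' s) (at s)" "Q 0 = y0"
    and defect: "vanishes n (\<lambda>s. G (Q s) - Q' s)"
  shows "vanishes (Suc n) (\<lambda>h. y (t0 + h) - Q h)"
proof -
  define R where "R h = y (t0 + h) - Q h" for h
  have y_t0: "y t0 = y0"
    and y_deriv: "\<And>t. t \<in> {t0..tend} \<Longrightarrow> (y has_vector_derivative G (y t)) (at t within {t0..tend})"
    using y by (auto simp: solves_ivp_def)
  have y_cont: "continuous_on {t0..tend} y"
    using y_deriv has_vector_derivative_continuous continuous_on_eq_continuous_within by blast
  have "(y \<longlongrightarrow> y t0) (at t0 within {t0..tend})"
    using y_cont t unfolding continuous_on_def by auto
  then have y_lim: "((\<lambda>h. y (t0 + h)) \<longlongrightarrow> y0) (at_right 0)"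
    using t y_t0 by (simp add: at_within_Icc_at_right filterlim_at_right_to_0[of _ _ t0] add.commute)
  have "isCont Q 0" using Q(1) has_vector_derivative_continuous by blast
  then have Q_lim: "(Q \<longlongrightarrow> y0) (at_right 0)"
    using Q(2) by (simp add: isCont_def filterlim_at_split)
  have R_deriv: "(R has_vector_derivative G (y (t0 + s)) - Q' s) (at s)" if "0 < s" "s < tend - t0" for s
  proof -
    have "(y has_vector_derivative G (y (t0 + s))) (at (t0 + s))"
      using y_deriv[of "t0 + s"] that by (simp add: at_within_Icc_at)
    moreover have "((\<lambda>s. t0 + s) has_vector_derivative 1) (at s)"
      by (auto intro!: derivative_eq_intros)
    ultimately have "(y \<circ> (\<lambda>s. t0 + s) has_vector_derivative 1 *\<^sub>R G (y (t0 + s))) (at s)"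
      by (intro vector_diff_chain_at)
    then show ?thesis
      unfolding R_def [abs_def] by (intro has_vector_derivative_diff Q(1)) (simp add: o_def)
  qed
  have "vanishes m R" if "m \<le> Suc n" for m
    using that
  proof (induction m)
    case 0
    have "(R \<longlongrightarrow> y0 - y0) (at_right 0)"
      unfolding R_def [abs_def] by (intro tendsto_diff y_lim Q_lim)
    then have "\<forall>\<^sub>F h in at_right 0. dist (R h) 0 < 1" by (intro tendstoD) auto
    then have "\<forall>\<^sub>F h in at_right 0. norm (R h) \<le> 1 * h ^ 0" by eventually_elim simp
    then show ?case unfolding vanishes_def by blast
  next
    case (Suc m)
    then have Rm: "vanishes m R" by simp
    have "\<forall>\<^sub>F s in at_right 0. dist (y (t0 + s)) y0 < 1" "\<forall>\<^sub>F s in at_right 0. dist (Q s) y0 < 1"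
      using y_lim Q_lim by (auto intro: tendstoD)
    then have "\<forall>\<^sub>F s in at_right 0. norm (G (y (t0 + s)) - G (Q s)) \<le> K * norm (R s)"
      by eventually_elim (use Lip(2) in \<open>auto simp: R_def dist_commute\<close>)
    then have "vanishes m (\<lambda>s. G (y (t0 + s)) - G (Q s))"
      by (rule vanishes_bound[OF Rm _ Lip(1)])
    from vanishes_add[OF this vanishes_mono[OF defect]] Suc.prems
    have "vanishes m (\<lambda>s. G (y (t0 + s)) - Q' s)" by simp
    then obtain C where C: "C \<ge> 0" "\<forall>\<^sub>F s in at_right 0. norm (G (y (t0 + s)) - Q' s) \<le> C * s ^ m"
      by (rule vanishesE)
    then obtain d where d: "d > 0" "\<And>s. 0 < s \<Longrightarrow> s < d \<Longrightarrow> norm (G (y (t0 + s)) - Q' s) \<le> C * s ^ m"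
      by (auto simp: eventually_at_right_field)
    \<comment> \<open>The minimum keeps the open interval from 0 to \<open>h\<close> inside the
      range of the derivative bound and \<open>t0 + h\<close> before \<open>tend\<close>.\<close>
    have "\<forall>\<^sub>F h in at_right 0. 0 < h \<and> h < min d (tend - t0)"
      using d(1) t by (intro eventually_small) simp
    then have "\<forall>\<^sub>F h in at_right 0. norm (R h) \<le> C * h ^ Suc m"
    proof eventually_elim
      case (elim h)
      have "continuous_on {0..h} Q"
        using Q(1) has_vector_derivative_continuous continuous_at_imp_continuous_on by blast
      moreover have "continuous_on {0..h} (\<lambda>s. y (t0 + s))"
        using elim by (intro continuous_on_compose2[OF y_cont] continuous_intros) auto
      ultimately have R_cont: "continuous_on {0..h} R"
        unfolding R_def [abs_def] by (intro continuous_on_diff)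
      \<comment> \<open>For fixed \<open>h\<close>, the linear majorant \<open>C * h ^ m * s\<close>
        dominates the growth of \<open>R\<close>, since \<open>s ^ m \<le> h ^ m\<close>. As
        \<open>R 0 = 0\<close>, one power of \<open>h\<close> is gained.\<close>
      have "norm (R h - R 0) \<le> C * h ^ m * h - C * h ^ m * 0"
      proof (rule differentiable_bound_general[OF _ R_cont])
        show "(R has_vector_derivative G (y (t0 + s)) - Q' s) (at s)" if "0 < s" "s < h" for s
          using that elim by (intro R_deriv) auto
        show "((\<lambda>s. C * h ^ m * s) has_vector_derivative C * h ^ m) (at s)" for s
          by (auto intro!: derivative_eq_intros)
        show "norm (G (y (t0 + s)) - Q' s) \<le> C * h ^ m" if "0 < s" "s < h" for s
        proof -
          have "norm (G (y (t0 + s)) - Q' s) \<le> C * s ^ m" using d(2) that elim by auto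
          also have "\<dots> \<le> C * h ^ m" using that C(1) by (intro mult_left_mono power_mono) auto
          finally show ?thesis .
        qed
      qed (use elim in \<open>auto intro!: continuous_intros\<close>)
      then show ?case by (simp add: R_def y_t0 Q(2) mult_ac)
    qed
    then show ?case unfolding vanishes_def by blast
  qed
  then show ?thesis by (simp add: R_def [abs_def])
qed

subsection \<open>The matrix exponential\<close>

lemma bounded_bilinear_matrix_mult:
  "bounded_bilinear ((**) :: real^'n^'m \<Rightarrow> real^'p^'n \<Rightarrow> real^'p^'m)"
  unfolding bilinear_conv_bounded_bilinear [symmetric] bilinear_def
  by (auto intro!: linearI simp: matrix_matrix_mult_def vec_eq_iff sum.distrib sum_distrib_left algebra_simps)

lemma mat_power_scaleR: "mat_power (c *\<^sub>R A) k = c ^ k *\<^sub>R mat_power A k"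
  by (induction k)
    (simp_all add: bounded_bilinear.scaleR_left[OF bounded_bilinear_matrix_mult]
      bounded_bilinear.scaleR_right[OF bounded_bilinear_matrix_mult])

text \<open>The norm of a product is bounded by the product of the norms up to a constant. Absorbing
  that constant into the base \<open>C\<close> keeps the growth geometric.\<close>

lemma mat_power_bound: "\<exists>C\<ge>0. \<forall>k. norm (mat_power A k) \<le> norm (mat 1 :: real^'n^'n) * C ^ k"
  for A :: "real^'n^'n"
proof -
  obtain C where C: "C \<ge> 0" "\<And>(X :: real^'n^'n) (Y :: real^'n^'n). norm (X ** Y) \<le> norm X * norm Y * C"
    using bounded_bilinear.nonneg_bounded[OF bounded_bilinear_matrix_mult] by metis
  have "norm (mat_power A k) \<le> norm (mat 1 :: real^'n^'n) * (norm A * C) ^ k" for k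
  proof (induction k)
    case (Suc k)
    have "norm (mat_power A (Suc k)) \<le> norm A * norm (mat_power A k) * C" using C(2) by simp
    also have "\<dots> \<le> norm A * (norm (mat 1 :: real^'n^'n) * (norm A * C) ^ k) * C"
      using Suc C(1) by (intro mult_left_mono mult_right_mono) auto
    finally show ?case by (simp add: mult_ac)
  qed simp
  with C(1) show ?thesis by (intro exI[of _ "norm A * C"]) auto
qed

text \<open>For \<open>0 < h < 1\<close> each tail term satisfies \<open>h ^ k \<le> h ^ n\<close>,
  so \<open>h ^ n\<close> factors out and a convergent scalar exponential series dominates the
  rest.\<close>

lemma mat_exp_remainder:
  "vanishes n (\<lambda>h. mat_exp (h *\<^sub>R A) - (\<Sum>k<n. (h ^ k / fact k) *\<^sub>R mat_power A k))"
proof -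
  define N where "N = norm (mat 1 :: real^'a^'a)"
  obtain C where C: "C \<ge> 0" "\<And>k. norm (mat_power A k) \<le> N * C ^ k"
    using mat_power_bound[of A] unfolding N_def by blast
  define e where "e k = N * (inverse (fact k) * C ^ k)" for k
  have "summable e" unfolding e_def by (intro summable_mult summable_exp)
  then have e_shift: "summable (\<lambda>i. e (i + n))" by (rule summable_ignore_initial_segment)
  \<comment> \<open>Used twice: with \<open>m = 0\<close> for convergence of the series, and with
    \<open>m = n\<close> for its tail.\<close>
  have bound: "norm ((h ^ k / fact k) *\<^sub>R mat_power A k) \<le> h ^ m * e k"
    if "0 < h" "h < 1" "m \<le> k" for h m k
  proof -
    have "norm ((h ^ k / fact k) *\<^sub>R mat_power A k) = (h ^ k / fact k) * norm (mat_power A k)"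
      using that by simp
    also have "\<dots> \<le> (h ^ m / fact k) * (N * C ^ k)"
      using that C by (intro mult_mono divide_right_mono power_decreasing) auto
    finally show ?thesis by (simp add: e_def field_simps)
  qed
  have "\<forall>\<^sub>F h in at_right 0. norm (mat_exp (h *\<^sub>R A) - (\<Sum>k<n. (h ^ k / fact k) *\<^sub>R mat_power A k))
      \<le> (\<Sum>i. e (i + n)) * h ^ n"
    using eventually_small[OF zero_less_one]
  proof eventually_elim
    case (elim h)
    let ?t = "\<lambda>k. (h ^ k / fact k) *\<^sub>R mat_power A k"
    have "norm (?t k) \<le> e k" for k
      using bound[of h 0 k] elim by simp
    then have "summable ?t"
      by (rule summable_comparison_test'[OF \<open>summable e\<close>])
    then have "mat_exp (h *\<^sub>R A) - (\<Sum>k<n. ?t k) = (\<Sum>i. ?t (i + n))"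
      using suminf_minus_initial_segment[of ?t n] by (simp add: mat_exp_def mat_power_scaleR)
    moreover have "norm (\<Sum>i. ?t (i + n)) \<le> (\<Sum>i. h ^ n * e (i + n))"
      using elim by (intro norm_suminf_le summable_mult e_shift bound) auto
    ultimately show ?case using suminf_mult[OF e_shift, of "h ^ n"] by (simp add: mult.commute)
  qed
  then show ?thesis unfolding vanishes_def by blast
qed

lemma mat_exp_vector_expansion:
  "vanishes 5 (\<lambda>h. mat_exp ((- h) *\<^sub>R M) *v x -
    (x - h *\<^sub>R (M *v x) + (h ^ 2 / 2) *\<^sub>R (M *v (M *v x)) - (h ^ 3 / 6) *\<^sub>R (M *v (M *v (M *v x)))
      + (h ^ 4 / 24) *\<^sub>R (M *v (M *v (M *v (M *v x))))))"
proof -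
  note lin = bounded_linear_matrix_vector_mult_left[where x = x]
  interpret bounded_linear "\<lambda>A :: real^'a^'a. A *v x" by (rule lin)
  have five: "{..<5::nat} = {0,1,2,3,4}" by auto
  have sign: "mat_power (- M) k *v x = (-1) ^ k *\<^sub>R (mat_power M k *v x)" for k
    using mat_power_scaleR[of "-1" M k] by (simp add: scaleR)
  have neg: "- M *v y = - (M *v y)" for y
    by (rule linear_neg[OF bounded_linear.linear[OF bounded_linear_matrix_vector_mult_left]])
  have power: "mat_power M 2 *v x = M *v (M *v x)" "mat_power M 3 *v x = M *v (M *v (M *v x))"
    "mat_power M 4 *v x = M *v (M *v (M *v (M *v x)))"
    by (simp_all add: eval_nat_numeral matrix_vector_mul_assoc)
  have "(\<Sum>k<5. (h ^ k / fact k) *\<^sub>R mat_power (- M) k) *v x =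
    x - h *\<^sub>R (M *v x) + (h ^ 2 / 2) *\<^sub>R (M *v (M *v x)) - (h ^ 3 / 6) *\<^sub>R (M *v (M *v (M *v x)))
      + (h ^ 4 / 24) *\<^sub>R (M *v (M *v (M *v (M *v x))))" for h
    by (simp add: five add diff sum scaleR sign power neg fact_numeral)
  then show ?thesis
    using vanishes_linear[OF lin mat_exp_remainder[of 5 "- M"]] by (simp add: diff)
qed

subsection \<open>Order four\<close>

theorem theorem2p2:
  fixes M :: "real^'n^'n" and f :: "real^'n \<Rightarrow> real^'n"
    and a :: "nat \<Rightarrow> nat \<Rightarrow> real" and b c :: "nat \<Rightarrow> real"
  assumes "sym_pos_def M \<or> skew_hermitian M"
    and "Ck 4 f"
    and "\<And>i. i \<in> {1..4} \<Longrightarrow> c i = (\<Sum>j = 1..<i. a i j)"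
    and "b 1 + b 2 + b 3 + b 4 = 1"
    and "b 2 * c 2 + b 3 * c 3 + b 4 * c 4 = 1/2"
    and "b 2 * c 2 ^ 2 + b 3 * c 3 ^ 2 + b 4 * c 4 ^ 2 = 1/3"
    and "b 3 * a 3 2 * c 2 + b 4 * a 4 2 * c 2 + b 4 * a 4 3 * c 3 = 1/6"
    and "b 2 * c 2 ^ 3 + b 3 * c 3 ^ 3 + b 4 * c 4 ^ 3 = 1/4"
    and "b 3 * c 3 * a 3 2 * c 2 + b 4 * c 4 * a 4 2 * c 2 + b 4 * c 4 * a 4 3 * c 3 = 1/8"
    and "b 3 * a 3 2 * c 2 ^ 2 + b 4 * a 4 2 * c 2 ^ 2 + b 4 * a 4 3 * c 3 ^ 2 = 1/12"
    and "b 4 * a 4 3 * a 3 2 * c 2 = 1/24"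
  shows "has_order 4 (mverk4_step a b M f) (vfield M f)"
  unfolding has_order_def
proof (intro allI impI)
  fix t0 tend :: real and y0 :: "real^'n" and y :: "real \<Rightarrow> real^'n"
  assume t: "t0 < tend" and y: "solves_ivp (vfield M f) t0 tend y0 y"
  have c: "c 2 = a 2 1" "c 3 = a 3 1 + a 3 2" "c 4 = a 4 1 + a 4 2 + a 4 3"
    using assms(3)[of 2] assms(3)[of 3] assms(3)[of 4]
    by (simp_all add: eval_nat_numeral)
  define G where "G = vfield M f"
  define g where "g = G y0"
  define A where "A = (*v) (jacobian f (at y0))"
  \<comment> \<open>\<open>A\<close> is the derivative of \<open>f\<close> at \<open>y0\<close> and
    \<open>L\<close> that of \<open>G\<close>.\<close>
  define L where "L p = A p - M *v p" for p
  define B where "B = second_deriv f y0"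
  have A_eq: "A p = L p + M *v p" for p by (simp add: L_def)
  have G_y0: "G y0 = g" by (simp add: g_def)
  have g_eq: "f y0 = g + M *v y0" by (simp add: g_def G_def vfield_def)
  define T where "T p = (\<Sum>i\<in>Basis. (p \<bullet> i) *\<^sub>R second_deriv (dirderiv i f) y0 p p)" for p
  \<comment> \<open>Both orders of the arguments together, as they occur in the \<open>h^3\<close>
    coefficient of \<open>expan4_compose\<close>.\<close>
  define S where "S = B g (L g) + B (L g) g"
  have "Ck (Suc 3) f" using assms(2) by (simp del: Ck.simps)
  note Ck_dir = Ck_Suc_dirderiv[OF this]
  have Ck1: "Ck 1 f" by (rule Ck_mono[OF assms(2)]) simp
  have bilB: "bounded_bilinear B"
    unfolding B_def by (rule bounded_bilinear_second_deriv[OF Ck_mono[OF assms(2)]]) simp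
  have bilT: "bounded_bilinear (second_deriv (dirderiv i f) y0)" for i
    by (rule bounded_bilinear_second_deriv[OF Ck_mono[OF Ck_dir]]) simp
  have linA: "A (p + q) = A p + A q" "A (r *\<^sub>R p) = r *\<^sub>R A p" "A (p - q) = A p - A q" for p q r
    by (simp_all add: A_def matrix_vector_right_distrib matrix_vector_mult_scaleR matrix_vector_mult_diff_distrib)
  have linM: "M *v (p + q) = M *v p + M *v q" "M *v (r *\<^sub>R p) = r *\<^sub>R (M *v p)"
    "M *v (p - q) = M *v p - M *v q" "M *v (- p) = - (M *v p)" for p q r
    using linear_neg[OF matrix_vector_mul_linear[of M], of p]
    by (simp_all add: matrix_vector_right_distrib matrix_vector_mult_scaleR matrix_vector_mult_diff_distrib)
  have B_scale: "B (r *\<^sub>R p) (s *\<^sub>R q) = (r * s) *\<^sub>R B p q" for r s p q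
    by (simp add: bounded_bilinear.scaleR_left[OF bilB] bounded_bilinear.scaleR_right[OF bilB])
  have T_scale: "T (r *\<^sub>R p) = r ^ 3 *\<^sub>R T p" for r p
    by (simp add: T_def bounded_bilinear.scaleR_left[OF bilT] bounded_bilinear.scaleR_right[OF bilT]
        scaleR_sum_right power3_eq_cube mult_ac)

  \<comment> \<open>All stages and the exact solution share one ansatz up to \<open>h^3\<close>:
    only the four scalars \<open>k\<close>, \<open>\<alpha>\<close>, \<open>\<beta>\<close>,
    \<open>\<gamma>\<close> in front of \<open>g\<close>, \<open>L g\<close>, \<open>B g g\<close>
    and \<open>L (L g)\<close> differ. One expansion therefore serves them all.\<close>
  have f_expansion: "expan4 (\<lambda>h. f (v h)) (f y0) (k *\<^sub>R A g) (\<alpha> *\<^sub>R A (L g) + (k^2 / 2) *\<^sub>R B g g)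
      (\<beta> *\<^sub>R A (B g g) + \<gamma> *\<^sub>R A (L (L g)) + (k * \<alpha> / 2) *\<^sub>R S + (k ^ 3 / 6) *\<^sub>R T g)"
    if "expan4 v y0 (k *\<^sub>R g) (\<alpha> *\<^sub>R L g) (\<beta> *\<^sub>R B g g + \<gamma> *\<^sub>R L (L g))" for v k \<alpha> \<beta> \<gamma>
    by (rule expan4_eq[OF expan4_compose[OF assms(2) that, folded A_def B_def T_def]])
      (simp_all add: linA B_scale T_scale S_def power2_eq_square algebra_simps)
  have G_expansion: "expan4 (\<lambda>h. G (v h)) g (k *\<^sub>R L g) (\<alpha> *\<^sub>R L (L g) + (k^2 / 2) *\<^sub>R B g g)
      (\<beta> *\<^sub>R A (B g g) + \<gamma> *\<^sub>R A (L (L g)) + (k * \<alpha> / 2) *\<^sub>R S + (k ^ 3 / 6) *\<^sub>R T g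
        - M *v (\<beta> *\<^sub>R B g g + \<gamma> *\<^sub>R L (L g)))"
    if v: "expan4 v y0 (k *\<^sub>R g) (\<alpha> *\<^sub>R L g) (\<beta> *\<^sub>R B g g + \<gamma> *\<^sub>R L (L g))" for v k \<alpha> \<beta> \<gamma>
  proof -
    have "expan4 (\<lambda>h. (-1) *\<^sub>R (M *v v h) + f (v h)) g (k *\<^sub>R L g) (\<alpha> *\<^sub>R L (L g) + (k^2 / 2) *\<^sub>R B g g)
      (\<beta> *\<^sub>R A (B g g) + \<gamma> *\<^sub>R A (L (L g)) + (k * \<alpha> / 2) *\<^sub>R S + (k ^ 3 / 6) *\<^sub>R T g
        - M *v (\<beta> *\<^sub>R B g g + \<gamma> *\<^sub>R L (L g)))"
      by (rule expan4_eq[OF expan4_add[OF expan4_scaleR[OF expan4_linear[OF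
              matrix_vector_mul_bounded_linear[of M] v]] f_expansion[OF v]]])
        (simp_all add: g_eq linM A_eq algebra_simps)
    then show ?thesis by (simp add: G_def vfield_def)
  qed

  \<comment> \<open>Expansions of the internal stages\<close>
  define Y2 where "Y2 h = y0 + (h * a 2 1) *\<^sub>R G y0" for h
  define Y3 where "Y3 h = y0 + h *\<^sub>R (a 3 1 *\<^sub>R G y0 + a 3 2 *\<^sub>R G (Y2 h))" for h
  define Y4 where "Y4 h = y0 + h *\<^sub>R (a 4 1 *\<^sub>R G y0 + a 4 2 *\<^sub>R G (Y2 h) + a 4 3 *\<^sub>R G (Y3 h))" for h
  \<comment> \<open>\<open>Y2\<close> is affine in \<open>h\<close>; the zero multiples put it into
    the shape of the ansatz.\<close>
  have Y2: "expan4 Y2 y0 (c 2 *\<^sub>R g) (0 *\<^sub>R L g) (0 *\<^sub>R B g g + 0 *\<^sub>R L (L g))"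
    using expan4_poly[of "\<lambda>h. 0" y0 "c 2 *\<^sub>R g" 0 0] by (simp add: Y2_def [abs_def] c G_y0)
  have Y3: "expan4 Y3 y0 (c 3 *\<^sub>R g) ((a 3 2 * c 2) *\<^sub>R L g)
      ((a 3 2 * c 2 ^ 2 / 2) *\<^sub>R B g g + 0 *\<^sub>R L (L g))"
    unfolding Y3_def [abs_def]
    by (rule expan4_eq[OF expan4_add[OF expan4_const expan4_shift[OF expan4_add[OF
            expan4_scaleR[OF expan4_const] expan4_scaleR[OF G_expansion[OF Y2]]]]]])
      (simp_all add: c G_y0 algebra_simps)
  have Y4: "expan4 Y4 y0 (c 4 *\<^sub>R g) ((a 4 2 * c 2 + a 4 3 * c 3) *\<^sub>R L g)
      ((a 4 2 * c 2 ^ 2 / 2 + a 4 3 * c 3 ^ 2 / 2) *\<^sub>R B g g + (a 4 3 * a 3 2 * c 2) *\<^sub>R L (L g))"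
    unfolding Y4_def [abs_def]
    by (rule expan4_eq[OF expan4_add[OF expan4_const expan4_shift[OF expan4_add[OF expan4_add[OF
            expan4_scaleR[OF expan4_const] expan4_scaleR[OF G_expansion[OF Y2]]]
            expan4_scaleR[OF G_expansion[OF Y3]]]]]])
      (simp_all add: c(3) G_y0 algebra_simps)

  \<comment> \<open>Expansion of the weighted sum of stage values\<close>
  define F where "F h = b 1 *\<^sub>R f y0 + b 2 *\<^sub>R f (Y2 h) + b 3 *\<^sub>R f (Y3 h) + b 4 *\<^sub>R f (Y4 h)" for h
  \<comment> \<open>The terms are grouped so that each scalar is the left-hand side of one of the
    eight order conditions, up to a numerical factor.\<close>
  have "expan4 F ((b 1 + b 2 + b 3 + b 4) *\<^sub>R f y0)
      ((b 2 * c 2 + b 3 * c 3 + b 4 * c 4) *\<^sub>R A g)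
      ((b 3 * a 3 2 * c 2 + b 4 * a 4 2 * c 2 + b 4 * a 4 3 * c 3) *\<^sub>R A (L g)
        + ((b 2 * c 2 ^ 2 + b 3 * c 3 ^ 2 + b 4 * c 4 ^ 2) / 2) *\<^sub>R B g g)
      (((b 3 * a 3 2 * c 2 ^ 2 + b 4 * a 4 2 * c 2 ^ 2 + b 4 * a 4 3 * c 3 ^ 2) / 2) *\<^sub>R A (B g g)
        + (b 4 * a 4 3 * a 3 2 * c 2) *\<^sub>R A (L (L g))
        + ((b 3 * c 3 * a 3 2 * c 2 + b 4 * c 4 * a 4 2 * c 2 + b 4 * c 4 * a 4 3 * c 3) / 2) *\<^sub>R S
        + ((b 2 * c 2 ^ 3 + b 3 * c 3 ^ 3 + b 4 * c 4 ^ 3) / 6) *\<^sub>R T g)"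
    unfolding F_def [abs_def]
    by (rule expan4_eq[OF expan4_add[OF expan4_add[OF expan4_add[OF
            expan4_scaleR[OF expan4_const] expan4_scaleR[OF f_expansion[OF Y2]]]
            expan4_scaleR[OF f_expansion[OF Y3]]] expan4_scaleR[OF f_expansion[OF Y4]]]])
      (simp_all add: algebra_simps add_divide_distrib)
  then have F: "expan4 F (f y0) ((1/2) *\<^sub>R A g) ((1/6) *\<^sub>R A (L g) + (1/6) *\<^sub>R B g g)
      ((1/24) *\<^sub>R A (B g g) + (1/24) *\<^sub>R A (L (L g)) + (1/16) *\<^sub>R S + (1/24) *\<^sub>R T g)"
    unfolding assms by simp

  \<comment> \<open>\<open>\<Phi>\<close> is the \<open>h\<^sup>3\<close> coefficient of \<open>G\<close> along \<open>Q\<close>; it does not involve the \<open>h\<^sup>4\<close> term of \<open>Q\<close>.\<close>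
  define \<Phi> where "\<Phi> = (1/6) *\<^sub>R A (B g g) + (1/6) *\<^sub>R A (L (L g)) + (1/4) *\<^sub>R S + (1/6) *\<^sub>R T g
    - M *v ((1/6) *\<^sub>R B g g + (1/6) *\<^sub>R L (L g))"
  \<comment> \<open>Matching powers of \<open>h\<close> in the differential equation gives
    \<open>k = 1\<close>, \<open>\<alpha> = 1/2\<close>, \<open>\<beta> = \<gamma> = 1/6\<close>;
    the last coefficient is \<open>\<Phi> / 4\<close> because \<open>h^4\<close> differentiates to
    \<open>4 h^3\<close>.\<close>
  define Q where "Q h = y0 + h *\<^sub>R g + h ^ 2 *\<^sub>R ((1/2) *\<^sub>R L g)
    + h ^ 3 *\<^sub>R ((1/6) *\<^sub>R B g g + (1/6) *\<^sub>R L (L g)) + h ^ 4 *\<^sub>R ((1/4) *\<^sub>R \<Phi>)" for h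
  define Q' where "Q' h = g + h *\<^sub>R L g + h ^ 2 *\<^sub>R ((1/2) *\<^sub>R L (L g) + (1/2) *\<^sub>R B g g) + h ^ 3 *\<^sub>R \<Phi>" for h

  \<comment> \<open>Approximation of the exact solution by \<open>Q\<close>\<close>
  have "expan4 Q y0 (1 *\<^sub>R g) ((1/2) *\<^sub>R L g) ((1/6) *\<^sub>R B g g + (1/6) *\<^sub>R L (L g))"
    unfolding Q_def [abs_def] scaleR_one by (rule expan4_poly) simp
  from G_expansion[OF this] have defect: "vanishes 4 (\<lambda>s. G (Q s) - Q' s)"
    by (simp add: expan4_def Q'_def \<Phi>_def)
  have Q_deriv: "(Q has_vector_derivative Q' s) (at s)" for s
    unfolding Q_def [abs_def] Q'_def
    by (auto intro!: derivative_eq_intros simp: algebra_simps)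
  have Q_0: "Q 0 = y0"
    unfolding Q_def by simp
  obtain Kf where Kf: "Kf \<ge> 0" "\<forall>x\<in>cball y0 1. \<forall>z\<in>cball y0 1. norm (f z - f x) \<le> Kf * norm (z - x)"
    using Ck_locally_Lipschitz[OF Ck1, of y0 1] by blast
  obtain Km where Km: "Km \<ge> 0" "\<And>w. norm (M *v w) \<le> norm w * Km"
    using bounded_linear.nonneg_bounded[OF matrix_vector_mul_bounded_linear, of M] by blast
  have Lip: "norm (G z - G x) \<le> (Kf + Km) * norm (z - x)" if "x \<in> cball y0 1" "z \<in> cball y0 1" for x z
  proof -
    have "G z - G x = (f z - f x) - M *v (z - x)" by (simp add: G_def vfield_def linM)
    then have "norm (G z - G x) \<le> norm (f z - f x) + norm (M *v (z - x))"
      by (simp add: norm_triangle_ineq4)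
    also have "\<dots> \<le> Kf * norm (z - x) + norm (z - x) * Km"
      using Kf(2) that by (intro add_mono Km(2)) blast
    finally show ?thesis by (simp add: algebra_simps)
  qed
  have "vanishes (Suc 4) (\<lambda>h. y (t0 + h) - Q h)"
    using Kf(1) Km(1)
    by (intro solution_minus_approximation[OF y[folded G_def] t _ Lip Q_deriv Q_0 defect]) auto
  then have exact: "vanishes 5 (\<lambda>h. y (t0 + h) - Q h)" by simp

  \<comment> \<open>Comparison of the numerical and the exact solution\<close>
  define E where "E h = y0 - h *\<^sub>R (M *v y0) + (h ^ 2 / 2) *\<^sub>R (M *v (M *v y0))
    - (h ^ 3 / 6) *\<^sub>R (M *v (M *v (M *v y0))) + (h ^ 4 / 24) *\<^sub>R (M *v (M *v (M *v (M *v y0))))" for h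
  define P where "P h = f y0 + h *\<^sub>R ((1/2) *\<^sub>R A g) + h ^ 2 *\<^sub>R ((1/6) *\<^sub>R A (L g) + (1/6) *\<^sub>R B g g)
    + h ^ 3 *\<^sub>R ((1/24) *\<^sub>R A (B g g) + (1/24) *\<^sub>R A (L (L g)) + (1/16) *\<^sub>R S + (1/24) *\<^sub>R T g)" for h
  have step: "mverk4_step a b M f h y0 = mat_exp ((- h) *\<^sub>R M) *v y0 + h *\<^sub>R F h + w4 M f h y0" for h
    by (simp add: mverk4_step_def Let_def F_def Y4_def Y3_def Y2_def G_def)
  have w4: "w4 M f h y0 = - ((h ^ 2 / 2) *\<^sub>R (M *v f y0)) + (h ^ 3 / 6) *\<^sub>R (M *v (M *v f y0) - M *v A g)
    + (h ^ 4 / 24) *\<^sub>R (- (M *v (M *v (M *v f y0))) + M *v (M *v A g) - M *v B g g - M *v A (L g))" for h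
  proof -
    have "(- M + jacobian f (at y0)) *v g = L g"
      unfolding L_def A_def using matrix_vector_mult_diff_rdistrib[of "jacobian f (at y0)" M g] by simp
    then show ?thesis
      unfolding w4_def Let_def G_def [symmetric] G_y0 A_def [symmetric] B_def [symmetric]
        matrix_vector_mul_assoc [symmetric]
      by (simp add: A_def fact_numeral)
  qed
  \<comment> \<open>An exact identity, without remainder. Writing \<open>A = L + M\<close> and
    \<open>f y0 = g + M y0\<close>, the correction \<open>w4\<close> cancels the surplus powers of
    \<open>M\<close> from \<open>E\<close> and from \<open>A\<close>, and supplies the terms
    \<open>- M *v B g g\<close> and \<open>- M *v L (L g)\<close> of the quartic coefficient. What
    remains is an identity of polynomials in each component.\<close>
  have poly: "E h + h *\<^sub>R P h + w4 M f h y0 = Q h" for h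
    unfolding E_def P_def w4 Q_def \<Phi>_def A_eq g_eq linM
    by (simp add: vec_eq_iff) (simp add: field_simps power2_eq_square power3_eq_cube power4_eq_xxxx)
  have "vanishes 5 (\<lambda>h. h ^ 1 *\<^sub>R (F h - P h))"
    using vanishes_scale_power[OF F[unfolded expan4_def], of 1] by (simp add: P_def)
  from vanishes_diff[OF vanishes_add[OF mat_exp_vector_expansion[of M y0] this] exact]
  have "vanishes 5 (\<lambda>h. mat_exp ((- h) *\<^sub>R M) *v y0 - E h + h ^ 1 *\<^sub>R (F h - P h) - (y (t0 + h) - Q h))"
    by (simp add: E_def)
  \<comment> \<open>Since the polynomial parts agree by \<open>poly\<close>, the local error is the
    sum of the three remainders: of the exponential, of the stage sum, and of the exact
    solution.\<close>
  also have "(\<lambda>h. mat_exp ((- h) *\<^sub>R M) *v y0 - E h + h ^ 1 *\<^sub>R (F h - P h) - (y (t0 + h) - Q h))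
      = (\<lambda>h. mverk4_step a b M f h y0 - y (t0 + h))"
    unfolding poly [symmetric] step by (simp add: fun_eq_iff algebra_simps)
  finally obtain C where C: "C \<ge> 0" "\<forall>\<^sub>F h in at_right 0. norm (mverk4_step a b M f h y0 - y (t0 + h)) \<le> C * h ^ 5"
    by (rule vanishesE)
  have "\<forall>\<^sub>F h in at_right 0. norm (norm (mverk4_step a b M f h y0 - y (t0 + h))) \<le> C * norm (h ^ (4 + 1) :: real)"
    using C(2) eventually_small[OF zero_less_one] by eventually_elim simp
  then show "(\<lambda>h. norm (mverk4_step a b M f h y0 - y (t0 + h))) \<in> O[at_right 0](\<lambda>h. h ^ (4 + 1))"
    by (rule bigoI)
qed

end
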